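(* Let $A$ and $b$ be as in the context and let $x_*$ be the unique solution of $Ax-\|x\|_1x=b$ with $\|x_*\|_1<1-\|a\|_{W}$. Let $g(\mu)=\|(A-\mu I)^{-1}b\|_1-\mu$ for $\mu\in[0,1-\|a\|_{W}]$. Then the sequence $\{\mu_k\}_{k\ge0}$ generated by Newton's iteration $$\mu_{k+1}=\mu_k-\frac{g(\mu_k)}{g'(\mu_k)},\qquad \mu_0=0,$$ converges to $\mu_*$, where $\mu_*=\|x_*\|_1$, and it satisfies $0\le\mu_k\le\mu_{k+1}\le\mu_*$ for all $k\ge 0$.
   Context: Let $n\ge 1$, let $a(z)=\sum_{i=1-n}^{n-1}a_iz^i$ have real coefficients, $T_n(a)$ the $n\times n$ Toeplitz matrix with $(T_n(a))_{i,j}=a_{j-i}$, and $\|a\|_{W}:=\sum_{i=1-n}^{n-1}|a_i|$. Set $A=(2-\|a\|_{W})I-T_n(a)$ and let $b\in\mathbb R^n$ be nonnegative and nonzero. Standing assumptions: $T_n(a)\ge 0$ (entrywise), $\|a\|_{W}+\|b\|_1<1$ and $\|b\|_1<(1-\|a\|_{W})^2$. Under these assumptions $A-\mu I$ is an invertible M-matrix for $\mu\in[0,1-\|a\|_{W}]$, and the equation $Ax-\|x\|_1x=b$ has exactly one solution with $\|x\|_1<1-\|a\|_{W}$. $\|\cdot\|_1$ is the vector 1-norm. *)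

theory Defs
  imports "HOL-Analysis.Derivative" "Jordan_Normal_Form.Gauss_Jordan_Elimination"
begin

text \<open>
  Vectors and matrices are those of Jordan_Normal_Form, so the size \<open>n\<close> is an ordinary
  natural number; the homonymous syntax and constants of HOL-Analysis are hidden.
\<close>

hide_type (open) Finite_Cartesian_Product.vec
hide_const (open) Finite_Cartesian_Product.vec Finite_Cartesian_Product.mat
no_notation Finite_Cartesian_Product.vec_nth (infixl "$" 90)

text \<open>
  The Laurent polynomial \<open>a(z)\<close> is given by its coefficients \<open>a :: int \<Rightarrow> real\<close>; only the
  values \<open>a i\<close> with \<open>1 - n \<le> i \<le> n - 1\<close> are ever used.
\<close>

definition wiener_norm :: "nat \<Rightarrow> (int \<Rightarrow> real) \<Rightarrow> real" where
  "wiener_norm n a = (\<Sum>i = 1 - int n..int n - 1. \<bar>a i\<bar>)"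

definition toeplitz :: "nat \<Rightarrow> (int \<Rightarrow> real) \<Rightarrow> real mat" where
  "toeplitz n a = mat n n (\<lambda>(i, j). a (int j - int i))"

definition norm1 :: "real vec \<Rightarrow> real" where
  "norm1 v = (\<Sum>i<dim_vec v. \<bar>v $ i\<bar>)"

definition coeff_mat :: "nat \<Rightarrow> (int \<Rightarrow> real) \<Rightarrow> real mat" where
  "coeff_mat n a = (2 - wiener_norm n a) \<cdot>\<^sub>m 1\<^sub>m n - toeplitz n a"

text \<open>
  The value is meaningful only where \<open>coeff_mat n a - t \<cdot>\<^sub>m 1\<^sub>m n\<close> is invertible, since
  \<^const>\<open>mat_inverse\<close> returns \<^const>\<open>None\<close> otherwise. Under the standing assumptions this is the
  case on the whole interval \<open>{0..1 - wiener_norm n a}\<close>.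
\<close>

definition newton_fun :: "nat \<Rightarrow> (int \<Rightarrow> real) \<Rightarrow> real vec \<Rightarrow> real \<Rightarrow> real" where
  "newton_fun n a b t =
     norm1 (the (mat_inverse (coeff_mat n a - t \<cdot>\<^sub>m 1\<^sub>m n)) *\<^sub>v b) - t"

text \<open>
  The derivative of \<^const>\<open>newton_fun\<close> as a function on \<open>{0..1 - wiener_norm n a}\<close>: one-sided at
  the two endpoints, the ordinary derivative in between.
\<close>

definition newton_fun_deriv :: "nat \<Rightarrow> (int \<Rightarrow> real) \<Rightarrow> real vec \<Rightarrow> real \<Rightarrow> real" where
  "newton_fun_deriv n a b t =
     vector_derivative (newton_fun n a b) (at t within {0..1 - wiener_norm n a})"

end

theory Submission
  imports Defs "Jordan_Normal_Form.Determinant"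
begin

text \<open>
  Write \<open>w\<close> for the Wiener norm, \<open>c = 1 - w\<close>, and \<open>R\<^sub>t = ((2 - w - t) I - T)\<^sup>-\<^sup>1\<close> for \<open>t\<close> in
  \<open>[0, c]\<close>, so that Newton's method runs on \<open>g(t) = h(t) - t\<close> with \<open>h(t)\<close> the 1-norm of \<open>R\<^sub>t b\<close>.
  The columns of \<open>T\<close> have sums at most \<open>w\<close>, and the shift \<open>2 - w - t\<close> exceeds \<open>w\<close> by at least
  \<open>c\<close>. Hence \<open>R\<^sub>t\<close> exists, is entrywise nonnegative, and its operator 1-norm is at most \<open>1 / c\<close>.

  Applying the resolvent identity twice gives the exact second-order expansion
  \<open>R\<^sub>u b = R\<^sub>t b + (u - t) R\<^sub>t R\<^sub>t b + (u - t)\<^sup>2 R\<^sub>u R\<^sub>t R\<^sub>t b\<close>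
  (\<open>resolvent_expansion\<close>). All vectors in it are nonnegative and the 1-norm is additive on
  nonnegative vectors, so the same expansion holds for \<open>h\<close>, with nonnegative coefficients. This one
  identity yields all that is needed: its linear coefficient is \<open>h'(t)\<close>, because the remainder is
  \<open>O((u - t)\<^sup>2)\<close>; the sign of the remainder puts the graph of \<open>h\<close> above its tangents; and the
  resolvent bound gives \<open>0 \<le> h'(t) \<le> q\<close> with \<open>q\<close> the quotient of the 1-norm of \<open>b\<close> by \<open>c\<^sup>2\<close>,
  which is below \<open>1\<close> by the second smallness assumption on \<open>b\<close>.

  So \<open>g\<close> is convex with slopes in \<open>[-1, q - 1]\<close> and vanishes at the 1-norm of \<open>x\<close>. To the left of
  the root of such a function Newton's method increases without overshooting, and the error shrinks
  at least by the factor \<open>q\<close> in every step (\<open>newton_monotone_convergence\<close>).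
\<close>

section \<open>Newton's method for a convex decreasing function with slopes in [-1, 0)\<close>

text \<open>
  The derivative is taken within a set, which covers the one-sided derivatives at the endpoints of
  an interval; the iteration starts at such an endpoint.
\<close>

lemma has_real_derivative_if_quadratic_remainder:
  fixes f :: "real \<Rightarrow> real"
  assumes "\<And>u. u \<in> S \<Longrightarrow> \<bar>f u - f t - (u - t) * d\<bar> \<le> K * (u - t)\<^sup>2"
  shows "(f has_real_derivative d) (at t within S)"
proof -
  have "\<bar>(f u - f t) / (u - t) - d\<bar> \<le> K * \<bar>u - t\<bar>" if "u \<in> S" "u \<noteq> t" for u
  proof -
    have "\<bar>(f u - f t) / (u - t) - d\<bar> = \<bar>f u - f t - (u - t) * d\<bar> / \<bar>u - t\<bar>"
      using that by (simp add: field_simps flip: abs_divide)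
    also have "\<dots> \<le> K * (u - t)\<^sup>2 / \<bar>u - t\<bar>"
      using assms[OF that(1)] by (intro divide_right_mono) auto
    also have "\<dots> = K * \<bar>u - t\<bar>"
      using that by (cases "t < u") (simp_all add: power2_eq_square abs_if field_simps)
    finally show ?thesis .
  qed
  then have "\<forall>\<^sub>F u in at t within S. norm ((f u - f t) / (u - t) - d) \<le> K * \<bar>u - t\<bar>"
    by (auto simp: eventually_at_filter)
  moreover have "((\<lambda>u. K * \<bar>u - t\<bar>) \<longlongrightarrow> 0) (at t within S)"
    by (rule tendsto_eq_intros refl | simp)+
  ultimately have "((\<lambda>u. (f u - f t) / (u - t) - d) \<longlongrightarrow> 0) (at t within S)"
    by (rule Lim_null_comparison)
  then show ?thesis
    by (simp add: has_field_derivative_iff LIM_zero_iff)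
qed

text \<open>
  The tangent at an iterate lies below \<open>f\<close>, so its zero, the next iterate, does not pass the root.
  The tangent at the root shows that \<open>f t\<close> is at least \<open>p (r - t)\<close>; since slopes are at least
  \<open>-1\<close>, a Newton step is at least as long as \<open>f t\<close>, hence it removes the fraction \<open>p\<close> of the
  remaining distance. The values \<open>D t\<close> may be any subgradients of \<open>f\<close>.
\<close>

lemma newton_monotone_convergence:
  fixes f D :: "real \<Rightarrow> real" and \<mu> :: "nat \<Rightarrow> real"
  assumes tangent: "\<And>t u. t \<in> {l..r} \<Longrightarrow> u \<in> {l..r} \<Longrightarrow> f t + D t * (u - t) \<le> f u"
    and slope: "\<And>t. t \<in> {l..r} \<Longrightarrow> -1 \<le> D t \<and> D t \<le> - p"
    and "0 < p" and root: "f r = 0"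
    and start: "\<mu> 0 \<in> {l..r}"
    and step: "\<And>k. \<mu> (Suc k) = \<mu> k - f (\<mu> k) / D (\<mu> k)"
  shows "\<mu> k \<in> {l..r} \<and> \<mu> k \<le> \<mu> (Suc k) \<and> \<mu> (Suc k) \<le> r"
    and "\<mu> \<longlonglongrightarrow> r"
proof -
  have one: "t \<le> N \<and> N \<le> r \<and> r - N \<le> (1 - p) * (r - t)"
    if t: "t \<in> {l..r}" and N: "N = t - f t / D t" for t N
  proof -
    have r: "r \<in> {l..r}"
      using t by auto
    have D: "-1 \<le> D t" "D t < 0"
      using slope[OF t] \<open>0 < p\<close> by auto
    \<comment> \<open>The tangent at the root bounds \<open>f\<close> from below by a line of slope at most \<open>-p\<close>.\<close>
    have "D r * (t - r) \<le> f t"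
      using tangent[OF r t] root by simp
    moreover have "p * (r - t) \<le> - D r * (r - t)"
      using slope[OF r] t by (intro mult_right_mono) auto
    ultimately have lower: "p * (r - t) \<le> f t"
      by (simp add: algebra_simps)
    moreover have "0 \<le> p * (r - t)"
      using t \<open>0 < p\<close> by simp
    ultimately have f0: "0 \<le> f t"
      by linarith
    then have long: "f t \<le> - (f t / D t)"
      using D mult_left_mono[of "-1" "D t" "f t"] by (simp add: field_simps)
    have "- (f t / D t) \<le> r - t"
      using tangent[OF t r] root D by (simp add: field_simps)
    then show ?thesis
      using N long f0 lower by (auto simp: algebra_simps)
  qed
  have range: "\<mu> k \<in> {l..r}" for k
  proof (induction k)
    case (Suc k)
    then show ?case
      using one[OF Suc step] by auto
  qed (rule start)
  then show "\<mu> k \<in> {l..r} \<and> \<mu> k \<le> \<mu> (Suc k) \<and> \<mu> (Suc k) \<le> r"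
    using one[OF _ step] by blast
  have p1: "p \<le> 1"
    using slope[OF start] by linarith
  have "r - \<mu> k \<le> (1 - p) ^ k * (r - \<mu> 0)" for k
  proof (induction k)
    case (Suc k)
    have "r - \<mu> (Suc k) \<le> (1 - p) * (r - \<mu> k)"
      using one[OF range step] by blast
    also have "\<dots> \<le> (1 - p) * ((1 - p) ^ k * (r - \<mu> 0))"
      using Suc p1 by (intro mult_left_mono) auto
    finally show ?case
      by (simp add: mult.assoc)
  qed simp
  then have "norm (r - \<mu> k) \<le> (1 - p) ^ k * (r - \<mu> 0)" for k
    using range[of k] by simp
  moreover have "(\<lambda>k. (1 - p) ^ k * (r - \<mu> 0)) \<longlonglongrightarrow> 0"
    using p1 \<open>0 < p\<close> by (intro tendsto_mult_left_zero LIMSEQ_power_zero) auto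
  ultimately have "(\<lambda>k. r - \<mu> k) \<longlonglongrightarrow> 0"
    by (intro Lim_null_comparison[of "\<lambda>k. r - \<mu> k"]) auto
  then have "(\<lambda>k. r - (r - \<mu> k)) \<longlonglongrightarrow> r - 0"
    by (intro tendsto_intros)
  then show "\<mu> \<longlonglongrightarrow> r"
    by simp
qed

section \<open>Resolvents of nonnegative matrices with bounded column sums\<close>

lemma norm1_nonneg: "0 \<le> norm1 v"
  by (simp add: norm1_def sum_nonneg)

lemma norm1_eq_0_imp: "v \<in> carrier_vec n \<Longrightarrow> norm1 v = 0 \<Longrightarrow> v = 0\<^sub>v n"
  by (intro eq_vecI) (auto simp: norm1_def sum_nonneg_eq_0_iff)

lemma norm1_smult: "norm1 (c \<cdot>\<^sub>v v) = \<bar>c\<bar> * norm1 v"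
  by (simp add: norm1_def abs_mult sum_distrib_left)

lemma norm1_triangle:
  "v \<in> carrier_vec n \<Longrightarrow> w \<in> carrier_vec n \<Longrightarrow> norm1 (v + w) \<le> norm1 v + norm1 w"
  by (auto simp: norm1_def sum.distrib[symmetric] intro!: sum_mono)

lemma carrier_vec_if_nonneg: "0\<^sub>v n \<le> v \<Longrightarrow> v \<in> carrier_vec n"
  unfolding less_eq_vec_def by (metis carrier_vecI index_zero_vec(2))

lemma norm1_if_nonneg: "0\<^sub>v n \<le> v \<Longrightarrow> norm1 v = (\<Sum>i<n. v $ i)"
  by (auto simp: norm1_def less_eq_vec_def)

text \<open>
  Column sums, and not row sums, are the natural quantity: for a nonnegative matrix the largest
  column sum is the operator norm induced by the 1-norm.
\<close>

locale nonneg_bounded_colsums =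
  fixes n :: nat and T :: "real mat" and w :: real
  assumes T_carrier [simp]: "T \<in> carrier_mat n n"
    and T_nonneg: "0\<^sub>m n n \<le> T"
    and colsum_le: "\<And>j. j < n \<Longrightarrow> (\<Sum>i<n. T $$ (i, j)) \<le> w"
    and w_nonneg: "0 \<le> w"
begin

definition shifted :: "real \<Rightarrow> real mat" where
  "shifted s = s \<cdot>\<^sub>m 1\<^sub>m n - T"

definition resolvent :: "real \<Rightarrow> real vec \<Rightarrow> real vec" where
  "resolvent s v = the (mat_inverse (shifted s)) *\<^sub>v v"

lemma T_dim [simp]: "dim_row T = n" "dim_col T = n"
  using carrier_matD[OF T_carrier] by auto

lemma T_entry_nonneg: "i < n \<Longrightarrow> j < n \<Longrightarrow> 0 \<le> T $$ (i, j)"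
  using T_nonneg by (auto simp: less_eq_mat_def)

lemma shifted_carrier [simp]: "shifted s \<in> carrier_mat n n"
  using T_carrier unfolding shifted_def by (intro minus_carrier_mat)

lemma T_mult_index:
  "v \<in> carrier_vec n \<Longrightarrow> i < n \<Longrightarrow> (T *\<^sub>v v) $ i = (\<Sum>j<n. T $$ (i, j) * v $ j)"
  by (auto simp: scalar_prod_def atLeast0LessThan)

lemma shifted_mult:
  "v \<in> carrier_vec n \<Longrightarrow> shifted s *\<^sub>v v = s \<cdot>\<^sub>v v - T *\<^sub>v v"
  unfolding shifted_def
  by (subst minus_mult_distrib_mat_vec[of _ n n]) auto

lemma T_total_le:
  assumes "\<And>j. j < n \<Longrightarrow> 0 \<le> f j"
  shows "(\<Sum>i<n. \<Sum>j<n. T $$ (i, j) * f j) \<le> w * (\<Sum>j<n. f j)"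
proof -
  have "(\<Sum>i<n. \<Sum>j<n. T $$ (i, j) * f j) = (\<Sum>j<n. (\<Sum>i<n. T $$ (i, j)) * f j)"
    by (subst sum.swap) (simp add: sum_distrib_right)
  also have "\<dots> \<le> (\<Sum>j<n. w * f j)"
    using assms colsum_le by (intro sum_mono mult_right_mono) auto
  finally show ?thesis
    by (simp add: sum_distrib_left)
qed

lemma norm1_T_mult_le:
  assumes v: "v \<in> carrier_vec n"
  shows "norm1 (T *\<^sub>v v) \<le> w * norm1 v"
proof -
  have "norm1 (T *\<^sub>v v) = (\<Sum>i<n. \<bar>\<Sum>j<n. T $$ (i, j) * v $ j\<bar>)"
    using v by (simp add: norm1_def T_mult_index del: index_mult_mat_vec)
  also have "\<dots> \<le> (\<Sum>i<n. \<Sum>j<n. T $$ (i, j) * \<bar>v $ j\<bar>)"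
    by (intro sum_mono order_trans[OF sum_abs]) (auto simp: abs_mult T_entry_nonneg intro!: sum_mono)
  also have "\<dots> \<le> w * (\<Sum>j<n. \<bar>v $ j\<bar>)"
    by (rule T_total_le) simp
  finally show ?thesis
    using v by (simp add: norm1_def)
qed

text \<open>
  This inverse bound is the triangle inequality for \<open>s v = (s I - T) v + T v\<close>. For \<open>s > w\<close> it
  gives both injectivity of \<open>s I - T\<close> and the norm bound on the resolvent.
\<close>

lemma norm1_le_shifted:
  assumes v: "v \<in> carrier_vec n" and "0 \<le> s"
  shows "(s - w) * norm1 v \<le> norm1 (shifted s *\<^sub>v v)"
proof -
  have "s \<cdot>\<^sub>v v = shifted s *\<^sub>v v + T *\<^sub>v v"
    using v by (intro eq_vecI) (auto simp: shifted_mult)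
  then have "s * norm1 v = norm1 (shifted s *\<^sub>v v + T *\<^sub>v v)"
    using norm1_smult[of s v] \<open>0 \<le> s\<close> by simp
  also have "\<dots> \<le> norm1 (shifted s *\<^sub>v v) + norm1 (T *\<^sub>v v)"
    using v by (intro norm1_triangle[of _ n]) (auto intro!: mult_mat_vec_carrier[of _ n n])
  finally show ?thesis
    using norm1_T_mult_le[OF v] by (simp add: algebra_simps)
qed

text \<open>
  The M-matrix property of \<open>s I - T\<close>. From \<open>s v \<ge> T v\<close> it follows that the negative part \<open>m\<close> of
  \<open>v\<close> satisfies \<open>s m \<le> T m\<close>. Summing the entries turns this into \<open>s \<le> w\<close> unless \<open>m = 0\<close>.
\<close>

lemma nonneg_if_shifted_nonneg:
  assumes v: "v \<in> carrier_vec n" and "w < s" and pos: "0\<^sub>v n \<le> shifted s *\<^sub>v v"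
  shows "0\<^sub>v n \<le> v"
proof -
  define m where "m i = max 0 (- v $ i)" for i
  have "s * m i \<le> (\<Sum>j<n. T $$ (i, j) * m j)" if "i < n" for i
  proof -
    have m0: "0 \<le> (\<Sum>j<n. T $$ (i, j) * m j)"
      using T_entry_nonneg that by (intro sum_nonneg) (auto simp: m_def)
    have "s * - v $ i \<le> (\<Sum>j<n. T $$ (i, j) * - v $ j)"
      using pos v that
      by (auto simp: shifted_mult less_eq_vec_def T_mult_index sum_negf simp del: index_mult_mat_vec)
    also have "\<dots> \<le> (\<Sum>j<n. T $$ (i, j) * m j)"
      using T_entry_nonneg that by (intro sum_mono mult_left_mono) (auto simp: m_def)
    finally show ?thesis
      using m0 by (auto simp: m_def max_def)
  qed
  then have "s * (\<Sum>i<n. m i) \<le> (\<Sum>i<n. \<Sum>j<n. T $$ (i, j) * m j)"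
    by (auto simp: sum_distrib_left intro!: sum_mono)
  also have "\<dots> \<le> w * (\<Sum>i<n. m i)"
    by (rule T_total_le) (simp add: m_def)
  finally have "(s - w) * (\<Sum>i<n. m i) \<le> 0"
    by (simp add: algebra_simps)
  moreover have m_nonneg: "0 \<le> (\<Sum>i<n. m i)"
    by (intro sum_nonneg) (simp add: m_def)
  ultimately have "(\<Sum>i<n. m i) = 0"
    using \<open>w < s\<close> by (simp add: mult_le_0_iff)
  then have "\<forall>i<n. m i = 0"
    by (subst (asm) sum_nonneg_eq_0_iff) (auto simp: m_def)
  then show ?thesis
    using v by (auto simp: less_eq_vec_def m_def max_def split: if_splits)
qed

lemma inverse_exists:
  assumes "w < s"
  obtains B where "mat_inverse (shifted s) = Some B" "B \<in> carrier_mat n n"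
    "shifted s * B = 1\<^sub>m n" "B * shifted s = 1\<^sub>m n"
proof -
  have "v = 0\<^sub>v n" if "v \<in> carrier_vec n" "shifted s *\<^sub>v v = 0\<^sub>v n" for v
  proof -
    have "(s - w) * norm1 v \<le> 0"
      using norm1_le_shifted[OF that(1), of s] that(2) assms w_nonneg by (simp add: norm1_def)
    then show ?thesis
      using that(1) assms norm1_nonneg[of v] by (intro norm1_eq_0_imp) (auto simp: mult_le_0_iff)
  qed
  then have "det (shifted s) \<noteq> 0"
    using det_0_iff_vec_prod_zero_field[OF shifted_carrier] by blast
  then have "mat_inverse (shifted s) \<noteq> None"
    using det_non_zero_imp_unit[OF shifted_carrier, of s "()"]
      mat_inverse(1)[OF shifted_carrier, of s "()"] by argo
  then show ?thesis
    using that mat_inverse(2)[OF shifted_carrier, of s] by fast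
qed

lemma resolvent_carrier:
  assumes "w < s" "v \<in> carrier_vec n"
  shows "resolvent s v \<in> carrier_vec n"
proof -
  obtain B where B: "mat_inverse (shifted s) = Some B" "B \<in> carrier_mat n n"
    "shifted s * B = 1\<^sub>m n" "B * shifted s = 1\<^sub>m n"
    using inverse_exists[OF assms(1)] .
  show ?thesis
    unfolding resolvent_def B(1) option.sel using B(2) assms(2) by (rule mult_mat_vec_carrier)
qed

lemma shifted_resolvent:
  assumes "w < s" "v \<in> carrier_vec n"
  shows "shifted s *\<^sub>v resolvent s v = v"
proof -
  obtain B where B: "mat_inverse (shifted s) = Some B" "B \<in> carrier_mat n n"
    "shifted s * B = 1\<^sub>m n" "B * shifted s = 1\<^sub>m n"
    using inverse_exists[OF assms(1)] .
  show ?thesis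
    unfolding resolvent_def B(1) option.sel
    using assoc_mult_mat_vec[OF shifted_carrier B(2) assms(2), of s] B(3) assms(2) by simp
qed

lemma resolvent_shifted:
  assumes "w < s" "v \<in> carrier_vec n"
  shows "resolvent s (shifted s *\<^sub>v v) = v"
proof -
  obtain B where B: "mat_inverse (shifted s) = Some B" "B \<in> carrier_mat n n"
    "shifted s * B = 1\<^sub>m n" "B * shifted s = 1\<^sub>m n"
    using inverse_exists[OF assms(1)] .
  show ?thesis
    unfolding resolvent_def B(1) option.sel
    using assoc_mult_mat_vec[OF B(2) shifted_carrier assms(2), of s] B(4) assms(2) by simp
qed

lemma resolvent_nonneg:
  assumes "w < s" "0\<^sub>v n \<le> v"
  shows "0\<^sub>v n \<le> resolvent s v"
proof -
  have v: "v \<in> carrier_vec n"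
    using assms(2) by (rule carrier_vec_if_nonneg)
  show ?thesis
    using nonneg_if_shifted_nonneg[OF resolvent_carrier[OF assms(1) v] assms(1)]
      shifted_resolvent[OF assms(1) v] assms(2) by simp
qed

lemma norm1_resolvent_le:
  assumes "w + c \<le> s" "0 < c" "v \<in> carrier_vec n"
  shows "norm1 (resolvent s v) \<le> norm1 v / c"
proof -
  have ws: "w < s"
    using assms by linarith
  have "c * norm1 (resolvent s v) \<le> (s - w) * norm1 (resolvent s v)"
    using assms norm1_nonneg by (intro mult_right_mono) auto
  also have "\<dots> \<le> norm1 v"
    using norm1_le_shifted[OF resolvent_carrier[OF ws assms(3)], of s]
      shifted_resolvent[OF ws assms(3)] ws w_nonneg by simp
  finally show ?thesis
    using assms(2) by (simp add: field_simps)
qed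

text \<open>
  Multiplying the right-hand side by \<open>s I - T - h I\<close> makes it telescope to \<open>v\<close>, so it is the
  unique preimage of \<open>v\<close>.
\<close>

lemma resolvent_expansion:
  assumes "w < s" "w < s - h" "v \<in> carrier_vec n"
  shows "resolvent (s - h) v = resolvent s v + h \<cdot>\<^sub>v resolvent s (resolvent s v)
    + h\<^sup>2 \<cdot>\<^sub>v resolvent (s - h) (resolvent s (resolvent s v))"
proof -
  define y where "y = resolvent s v"
  define z where "z = resolvent s y"
  define e where "e = resolvent (s - h) z"
  have carrier: "y \<in> carrier_vec n" "z \<in> carrier_vec n" "e \<in> carrier_vec n"
    unfolding y_def z_def e_def using assms by (auto intro!: resolvent_carrier)
  have eqs: "s \<cdot>\<^sub>v y - T *\<^sub>v y = v" "s \<cdot>\<^sub>v z - T *\<^sub>v z = y" "(s - h) \<cdot>\<^sub>v e - T *\<^sub>v e = z"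
    using assms carrier shifted_mult[of _ s] shifted_mult[of _ "s - h"]
      shifted_resolvent[of s] shifted_resolvent[of "s - h"]
    unfolding y_def z_def e_def by metis+
  have T_lin: "T *\<^sub>v (y + h \<cdot>\<^sub>v z + h\<^sup>2 \<cdot>\<^sub>v e) = T *\<^sub>v y + h \<cdot>\<^sub>v (T *\<^sub>v z) + h\<^sup>2 \<cdot>\<^sub>v (T *\<^sub>v e)"
    using carrier carrier[THEN mult_mat_vec_carrier[OF T_carrier]]
    by (simp add: mult_add_distrib_mat_vec[of _ n n] mult_mat_vec[of _ n n])
  have "shifted (s - h) *\<^sub>v (y + h \<cdot>\<^sub>v z + h\<^sup>2 \<cdot>\<^sub>v e) = v"
  proof (rule eq_vecI)
    fix i assume "i < dim_vec v"
    then have i: "i < n"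
      using assms by auto
    have "s * y $ i - (T *\<^sub>v y) $ i = v $ i" "s * z $ i - (T *\<^sub>v z) $ i = y $ i"
      "(s - h) * e $ i - (T *\<^sub>v e) $ i = z $ i"
      using eqs[THEN arg_cong[of _ _ "\<lambda>u. u $ i"]] i carrier by (simp_all del: index_mult_mat_vec)
    then have Ti: "(T *\<^sub>v y) $ i = s * y $ i - v $ i" "(T *\<^sub>v z) $ i = s * z $ i - y $ i"
      "(T *\<^sub>v e) $ i = (s - h) * e $ i - z $ i"
      by simp_all
    show "(shifted (s - h) *\<^sub>v (y + h \<cdot>\<^sub>v z + h\<^sup>2 \<cdot>\<^sub>v e)) $ i = v $ i"
      using i carrier
      by (simp add: shifted_mult T_lin Ti del: index_mult_mat_vec assoc_add_vec)
        (simp add: algebra_simps power2_eq_square)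
  qed (use assms carrier_matD(1)[OF shifted_carrier] in auto)
  then show ?thesis
    using resolvent_shifted[of "s - h" "y + h \<cdot>\<^sub>v z + h\<^sup>2 \<cdot>\<^sub>v e"] assms carrier
    by (simp add: y_def z_def e_def)
qed

text \<open>
  Nonnegativity makes every 1-norm a plain sum of entries, hence linear, which turns the vector
  identity into one for the norms.
\<close>

lemma norm1_resolvent_expansion:
  assumes "w < s" "w < s - h" "0\<^sub>v n \<le> v"
  shows "norm1 (resolvent (s - h) v) = norm1 (resolvent s v) + h * norm1 (resolvent s (resolvent s v))
    + h\<^sup>2 * norm1 (resolvent (s - h) (resolvent s (resolvent s v)))"
proof -
  have v: "v \<in> carrier_vec n"
    using assms(3) by (rule carrier_vec_if_nonneg)
  let ?y = "resolvent s v" and ?z = "resolvent s (resolvent s v)"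
  let ?e = "resolvent (s - h) ?z"
  have carrier: "?y \<in> carrier_vec n" "?z \<in> carrier_vec n" "?e \<in> carrier_vec n"
    using assms v by (auto intro!: resolvent_carrier)
  have "0\<^sub>v n \<le> ?y" "0\<^sub>v n \<le> ?z" "0\<^sub>v n \<le> ?e" "0\<^sub>v n \<le> resolvent (s - h) v"
    using assms by (auto intro!: resolvent_nonneg)
  note sums = this[THEN norm1_if_nonneg]
  have "(\<Sum>i<n. resolvent (s - h) v $ i) = (\<Sum>i<n. ?y $ i + h * ?z $ i + h\<^sup>2 * ?e $ i)"
    using carrier by (intro sum.cong) (auto simp: resolvent_expansion[OF assms(1,2) v])
  then show ?thesis
    by (simp add: sums sum.distrib sum_distrib_left)
qed

end

section \<open>The Toeplitz equation\<close>

text \<open>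
  The entries of a column carry distinct diagonals \<open>j - i\<close>, all within the range of the Wiener norm.
\<close>

lemma toeplitz_colsum_le:
  assumes "j < n"
  shows "(\<Sum>i<n. toeplitz n a $$ (i, j)) \<le> wiener_norm n a"
proof -
  have "(\<Sum>i<n. toeplitz n a $$ (i, j)) \<le> (\<Sum>i<n. \<bar>a (int j - int i)\<bar>)"
    using assms by (intro sum_mono) (auto simp: toeplitz_def)
  also have "\<dots> = (\<Sum>k\<in>(\<lambda>i. int j - int i) ` {..<n}. \<bar>a k\<bar>)"
    by (subst sum.reindex) (auto simp: inj_on_def)
  also have "\<dots> \<le> wiener_norm n a"
    unfolding wiener_norm_def using assms by (intro sum_mono2) auto
  finally show ?thesis .
qed

theorem theorem3p3:
  fixes n :: nat and a :: "int \<Rightarrow> real" and b x :: "real vec" and \<mu> :: "nat \<Rightarrow> real"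
  assumes "n \<ge> 1"
    and "b \<in> carrier_vec n" and "0\<^sub>v n \<le> b" and "b \<noteq> 0\<^sub>v n"
    and "0\<^sub>m n n \<le> toeplitz n a"
    and "wiener_norm n a + norm1 b < 1"
    and "norm1 b < (1 - wiener_norm n a)\<^sup>2"
    and "x \<in> carrier_vec n"
    and "coeff_mat n a *\<^sub>v x - norm1 x \<cdot>\<^sub>v x = b"
    and "norm1 x < 1 - wiener_norm n a"
    and "\<mu> 0 = 0"
    and "\<And>k. \<mu> (Suc k) = \<mu> k - newton_fun n a b (\<mu> k) / newton_fun_deriv n a b (\<mu> k)"
  shows "(\<forall>k. newton_fun n a b differentiable (at (\<mu> k) within {0..1 - wiener_norm n a})
              \<and> newton_fun_deriv n a b (\<mu> k) \<noteq> 0)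
         \<and> \<mu> \<longlonglongrightarrow> norm1 x
         \<and> (\<forall>k. 0 \<le> \<mu> k \<and> \<mu> k \<le> \<mu> (Suc k) \<and> \<mu> (Suc k) \<le> norm1 x)"
proof -
  define w where "w = wiener_norm n a"
  define c where "c = 1 - w"
  define T where "T = toeplitz n a"
  interpret nonneg_bounded_colsums n T w
    using assms(5) toeplitz_colsum_le[of _ n a]
    by unfold_locales (auto simp: T_def w_def toeplitz_def wiener_norm_def sum_nonneg)
  have c: "0 < c"
    using assms(6) norm1_nonneg[of b] by (simp add: c_def w_def)
  define q where "q = norm1 b / c\<^sup>2"
  have q: "q < 1"
    using assms(7) c by (simp add: q_def c_def w_def)
  have coeff_shift: "coeff_mat n a - t \<cdot>\<^sub>m 1\<^sub>m n = shifted (2 - w - t)" for t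
    unfolding coeff_mat_def shifted_def
    by (intro eq_matI) (auto simp: T_def w_def toeplitz_def algebra_simps)
  \<comment> \<open>In terms of the shift \<open>s = 2 - w - t\<close>, moving from \<open>t\<close> to \<open>u\<close> lowers \<open>s\<close> by \<open>u - t\<close>.\<close>
  define h where "h t = norm1 (resolvent (2 - w - t) b)" for t
  have newton_fun_eq: "newton_fun n a b = (\<lambda>t. h t - t)"
    by (auto simp: newton_fun_def h_def resolvent_def coeff_shift)
  define d where "d t = norm1 (resolvent (2 - w - t) (resolvent (2 - w - t) b))" for t
  define e where
    "e t u = norm1 (resolvent (2 - w - u) (resolvent (2 - w - t) (resolvent (2 - w - t) b)))" for t u
  have gap: "w + c \<le> 2 - w - t" "w < 2 - w - t" if "t \<in> {0..c}" for t
    using that c by (auto simp: c_def)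
  have expand: "h u = h t + (u - t) * d t + (u - t)\<^sup>2 * e t u" if "t \<in> {0..c}" "u \<in> {0..c}" for t u
  proof -
    have "2 - w - t - (u - t) = 2 - w - u"
      by simp
    then show ?thesis
      using norm1_resolvent_expansion[of "2 - w - t" "u - t" b] gap(2)[OF that(1)] gap(2)[OF that(2)] assms(3)
      unfolding h_def d_def e_def by metis
  qed
  have e_nonneg: "0 \<le> e t u" for t u
    by (simp add: e_def norm1_nonneg)
  have d_nonneg: "0 \<le> d t" for t
    by (simp add: d_def norm1_nonneg)
  have d_le: "d t \<le> q" if "t \<in> {0..c}" for t
  proof -
    note R = norm1_resolvent_le[OF gap(1)[OF that] c]
    have "d t \<le> norm1 (resolvent (2 - w - t) b) / c"
      unfolding d_def using gap[OF that] assms(2) by (intro R resolvent_carrier)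
    also have "\<dots> \<le> norm1 b / c / c"
      using c by (intro divide_right_mono R assms(2)) auto
    finally show ?thesis
      by (simp add: q_def power2_eq_square)
  qed
  have e_le: "e t u \<le> q / c" if "t \<in> {0..c}" "u \<in> {0..c}" for t u
  proof -
    have "e t u \<le> d t / c"
      unfolding e_def d_def using gap[OF that(1)] gap[OF that(2)] assms(2) c
      by (intro norm1_resolvent_le resolvent_carrier) auto
    also have "\<dots> \<le> q / c"
      using d_le[OF that(1)] c by (intro divide_right_mono) auto
    finally show ?thesis .
  qed
  have deriv: "(newton_fun n a b has_real_derivative d t - 1) (at t within {0..c})" if "t \<in> {0..c}" for t
  proof (rule has_real_derivative_if_quadratic_remainder)
    fix u assume u: "u \<in> {0..c}"
    have "newton_fun n a b u - newton_fun n a b t - (u - t) * (d t - 1) = e t u * (u - t)\<^sup>2"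
      using expand[OF that u] by (simp add: newton_fun_eq algebra_simps)
    also have "\<bar>\<dots>\<bar> \<le> q / c * (u - t)\<^sup>2"
      using e_le[OF that u] e_nonneg[of t u] by (simp only: abs_mult abs_power2 abs_of_nonneg mult_right_mono zero_le_power2)
    finally show "\<bar>newton_fun n a b u - newton_fun n a b t - (u - t) * (d t - 1)\<bar> \<le> q / c * (u - t)\<^sup>2" .
  qed
  have deriv_eq: "newton_fun_deriv n a b t = d t - 1" if "t \<in> {0..c}" for t
    unfolding newton_fun_deriv_def using deriv[OF that] that c
    by (intro vector_derivative_within_closed_interval)
      (auto simp: c_def w_def has_real_derivative_iff_has_vector_derivative)
  have tangent: "newton_fun n a b t + newton_fun_deriv n a b t * (u - t) \<le> newton_fun n a b u"
    if "t \<in> {0..c}" "u \<in> {0..c}" for t u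
    using expand[OF that] e_nonneg[of t u]
    by (simp add: deriv_eq[OF that(1)] newton_fun_eq algebra_simps)
  have x_range: "{0..norm1 x} \<subseteq> {0..c}" "norm1 x \<in> {0..c}"
    using assms(10) norm1_nonneg[of x] by (auto simp: c_def w_def)
  \<comment> \<open>The equation says that \<open>x\<close> is the resolvent of \<open>b\<close> at its own norm, so \<open>h\<close> fixes this norm.\<close>
  have "shifted (2 - w - norm1 x) *\<^sub>v x = b"
    unfolding coeff_shift[symmetric] assms(9)[symmetric]
    using assms(8) by (subst minus_mult_distrib_mat_vec[of _ n n]) (auto simp: coeff_mat_def toeplitz_def)
  then have "resolvent (2 - w - norm1 x) b = x"
    using resolvent_shifted[OF gap(2)[OF x_range(2)] assms(8)] by simp
  then have root: "newton_fun n a b (norm1 x) = 0"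
    by (simp add: newton_fun_eq h_def)
  note newton = newton_monotone_convergence[of 0 "norm1 x" "newton_fun n a b" "newton_fun_deriv n a b" "1 - q" \<mu>]
  have range: "\<mu> k \<in> {0..norm1 x} \<and> \<mu> k \<le> \<mu> (Suc k) \<and> \<mu> (Suc k) \<le> norm1 x" for k
    using x_range(1) d_nonneg d_le q assms(11,12) norm1_nonneg[of x]
    by (intro newton tangent root) (auto simp: deriv_eq subset_iff)
  have limit: "\<mu> \<longlonglongrightarrow> norm1 x"
    using x_range(1) d_nonneg d_le q assms(11,12) norm1_nonneg[of x]
    by (intro newton tangent root) (auto simp: deriv_eq subset_iff)
  have \<mu>_range: "\<mu> k \<in> {0..c}" for k
    using range[of k] x_range(1) by blast
  have "newton_fun n a b differentiable (at (\<mu> k) within {0..c})" for k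
    using deriv[OF \<mu>_range] real_differentiable_def by blast
  moreover have "newton_fun_deriv n a b (\<mu> k) \<noteq> 0" for k
    using deriv_eq[OF \<mu>_range] d_le[OF \<mu>_range, of k] q by simp
  ultimately show ?thesis
    using range limit by (auto simp: c_def w_def)
qed

end
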